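(* Let $m\geq n>0$ and $p,q\geq 0$ be integers. Let $\{s_i\}_{i\geq 1}$ be the sequence consisting of $p$ ones, followed by $\binom{m}{0},\binom{m}{1},\ldots,\binom{m}{m}$, followed by zeros, and let $\{t_i\}_{i\geq 1}$ be the sequence consisting of $q$ ones, followed by $\binom{n}{0},\binom{n}{1},\ldots,\binom{n}{n}$, followed by zeros. Let $\{r_i\}_{i\geq 1}$ be their convolution, $r_i=\sum_{j=1}^{i}s_j\,t_{i-j+1}$ for $i\geq 1$. Then the sequence $\{r_i\}_{i\geq 1}$ is unimodal if and only if at least one of the following conditions holds: (i) $m>q$; (ii) $n>p$; (iii) $m=n=2$; (iv) $n=1$.
   Context: A sequence $(a_i)_{i\ge 1}$ of real numbers is unimodal if there is an index $k$ such that $a_1\leq a_2\leq\cdots\leq a_k\geq a_{k+1}\geq a_{k+2}\geq\cdots$. Explicitly, $s_i=1$ for $1\le i\le p$, $s_{p+1+l}=\binom{m}{l}$ for $0\le l\le m$, and $s_i=0$ for $i>p+m+1$; similarly for $t_i$ with $q,n$ in place of $p,m$. *)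

theory Defs
  imports Complex_Main
begin

(* A sequence (a_i) with i >= 1 is a function on nat; its value at index 0 is ignored. *)
definition unimodal :: "(nat \<Rightarrow> real) \<Rightarrow> bool" where
  "unimodal a \<longleftrightarrow>
     (\<exists>k\<ge>1. (\<forall>i. 1 \<le> i \<and> i < k \<longrightarrow> a i \<le> a (i + 1)) \<and> (\<forall>i\<ge>k. a i \<ge> a (i + 1)))"

definition ones_binom_seq :: "nat \<Rightarrow> nat \<Rightarrow> nat \<Rightarrow> real" where
  "ones_binom_seq p m i =
     (if 1 \<le> i \<and> i \<le> p then 1
      else if p + 1 \<le> i \<and> i \<le> p + m + 1 then real (m choose (i - (p + 1)))
      else 0)"

definition seq_conv :: "(nat \<Rightarrow> real) \<Rightarrow> (nat \<Rightarrow> real) \<Rightarrow> nat \<Rightarrow> real" where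
  "seq_conv s t i = (\<Sum>j = 1..i. s j * t (i - j + 1))"

end

theory Submission
  imports Defs "HOL-Computational_Algebra.Formal_Power_Series"
begin

text \<open>
  Let \<open>S\<close> and \<open>T\<close> be the generating functions of the two sequences. Multiplication by \<open>1 - X\<close>
  turns a block of \<open>p\<close> ones into \<open>1 - X^p\<close>, so the differences of the convolution, the coefficients of \<open>(1 - X) S T\<close>,
  are explicit: beyond index \<open>p + q\<close> the \<open>i\<close>-th one is
  \<open>C(n, p + i) + C(m, q + i) + b(m + n, i) - C(m, i) - C(n, i)\<close>, where \<open>b(N, i) = C(N, i) - C(N, i - 1)\<close>.
  If \<open>m \<le> q\<close> and \<open>n \<le> p\<close>, the values at \<open>i = 1, 2\<close> are \<open>-1\<close> and \<open>(m - 1) (n - 1) - 1\<close>, which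
  breaks unimodality except when \<open>n = 1\<close> or \<open>m = n = 2\<close>. If \<open>m > q\<close> or \<open>n > p\<close>, the differences are
  nonnegative for \<open>i \<le> n\<close>, and for \<open>i > n\<close> they are coefficients of \<open>(1 + X)^m\<close> times
  \<open>1 + X^q ((1 - X) (1 + X)^n - 1)\<close>. The latter factor has a single sign change, a property
  that multiplication by \<open>1 + X\<close> preserves.
\<close>

section \<open>Sequences with a single sign change\<close>

definition crosses_at :: "nat \<Rightarrow> (nat \<Rightarrow> real) \<Rightarrow> bool" where
  "crosses_at K c \<longleftrightarrow> (\<forall>k<K. c k \<ge> 0) \<and> (\<forall>k\<ge>K. c k \<le> 0)"

text \<open>Below \<open>K\<close> only nonnegative terms are added, above \<open>K\<close> only
  nonpositive ones. At \<open>K\<close> itself the signs may differ, so the sign of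
  \<open>c' K\<close> decides whether the crossing stays or moves to \<open>Suc K\<close>.\<close>

lemma crosses_at_step:
  assumes "crosses_at K c" "c' 0 = c 0" "\<And>k. c' (Suc k) = c (Suc k) + c k"
  shows "\<exists>K'. crosses_at K' c'"
proof (cases "c' K \<ge> 0")
  case True
  have "c' k \<ge> 0" if "k < Suc K" for k
    using that assms True by (cases "k = K"; cases k) (auto simp: crosses_at_def)
  moreover have "c' k \<le> 0" if "k \<ge> Suc K" for k
    using that assms by (cases k) (auto simp: crosses_at_def intro!: add_nonpos_nonpos)
  ultimately show ?thesis
    unfolding crosses_at_def by blast
next
  case False
  have "c' k \<ge> 0" if "k < K" for k
    using that assms by (cases k) (auto simp: crosses_at_def)
  moreover have "c' k \<le> 0" if "k \<ge> K" for k
    using that assms False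
    by (cases "k = K"; cases k) (auto simp: crosses_at_def intro!: add_nonpos_nonpos)
  ultimately show ?thesis
    unfolding crosses_at_def by blast
qed

section \<open>Differences of consecutive binomial coefficients\<close>

lemma zero_choose: "(0 :: nat) choose k = (if k = 0 then 1 else 0)"
  by (cases k) auto

text \<open>These are the coefficients of \<open>(1 - X) (1 + X)^N\<close>, so they obey Pascal's
  rule.\<close>

definition ballot :: "nat \<Rightarrow> nat \<Rightarrow> real" where
  "ballot N i = real (N choose i) - (if i = 0 then 0 else real (N choose (i - 1)))"

lemma ballot_0 [simp]: "ballot N 0 = 1"
  by (simp add: ballot_def)

lemma ballot_1: "ballot N (Suc 0) = real N - 1"
  by (simp add: ballot_def)

lemma ballot_Suc_Suc: "ballot (Suc N) (Suc i) = ballot N (Suc i) + ballot N i"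
  by (cases i) (simp_all add: ballot_def)

lemma crosses_at_ballot: "\<exists>K. crosses_at K (ballot N)"
proof (induction N)
  case 0
  have "crosses_at 1 (ballot 0)"
    by (auto simp: crosses_at_def ballot_def zero_choose)
  then show ?case ..
next
  case (Suc N)
  then obtain K where "crosses_at K (ballot N)" ..
  then show ?case
    by (rule crosses_at_step) (simp_all add: ballot_Suc_Suc)
qed

lemma ballot_odd_middle: "ballot (Suc (2 * i)) (Suc i) = 0"
  using binomial_symmetric[of i "Suc (2 * i)"] by (simp add: ballot_def mult_2)

text \<open>Induction on \<open>i\<close>, starting from the corner \<open>m = n = i\<close> and
  raising first \<open>m\<close>, then \<open>n\<close>. By Pascal's rule one raise adds a ballot
  term of the previous order on the right and a single binomial on the left; the induction
  hypothesis bounds the latter by the former.\<close>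

lemma ballot_ge_binomials:
  assumes "2 \<le> i" "i \<le> m" "i \<le> n"
  shows "real (m choose i) + real (n choose i) \<le> ballot (m + n) i"
  using assms
proof (induction i arbitrary: m n)
  case (Suc i)
  have single: "real (m choose i) \<le> ballot (m + n) i" if "i \<le> m" "i \<le> n" for m n
  proof (cases "i = 1")
    case True
    then show ?thesis using that by (simp add: ballot_1)
  next
    case False
    then show ?thesis using Suc.IH[of m n] Suc.prems that by auto
  qed
  have double: "2 \<le> ballot (Suc (2 * i)) i"
  proof (cases "i = 1")
    case False
    then have "real (Suc i choose i) + real (i choose i) \<le> ballot (Suc i + i) i"
      using Suc.IH[of "Suc i" i] Suc.prems by auto
    then show ?thesis by (simp add: mult_2)
  qed (simp add: ballot_1)
  \<comment> \<open>Pascal's rule splits the right side into the vanishing middle term of an odd row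
    and the term bounded in \<open>double\<close>.\<close>
  have diagonal: "real (Suc i choose Suc i) + real (Suc i choose Suc i) \<le> ballot (Suc i + Suc i) (Suc i)"
    using double ballot_odd_middle[of i] ballot_Suc_Suc[of "Suc (2 * i)" i] by (simp add: mult_2)
  have row: "real (m choose Suc i) + 1 \<le> ballot (m + Suc i) (Suc i)" if "Suc i \<le> m" for m
    using that
  proof (induction m rule: dec_induct)
    case base
    then show ?case using diagonal by simp
  next
    case (step m)
    then show ?case using single[of m "Suc i"] ballot_Suc_Suc[of "m + Suc i" i] by simp
  qed
  show ?case
    using \<open>Suc i \<le> n\<close>
  proof (induction n rule: dec_induct)
    case base
    then show ?case using row[OF \<open>Suc i \<le> m\<close>] by simp
  next
    case (step n)
    then show ?case
      using single[of n m] \<open>Suc i \<le> m\<close> ballot_Suc_Suc[of "m + n" i] by (simp add: add.commute)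
  qed
qed simp

text \<open>These are the coefficients of
  \<open>(1 + X)^m (1 + X^q ((1 - X) (1 + X)^n - 1))\<close>; each induction step multiplies by
  \<open>1 + X\<close>.\<close>

lemma crosses_at_shifted_ballot:
  "\<exists>K. crosses_at K (\<lambda>k. real (m choose k) +
     (if k < q then 0 else ballot (m + n) (k - q) - real (m choose (k - q))))"
proof (induction m)
  case 0
  obtain K where K: "crosses_at K (ballot n)"
    using crosses_at_ballot by blast
  \<comment> \<open>\<open>ballot n 0 = 1\<close> forces this; it keeps index 0 on the nonnegative
    side even when \<open>q = 0\<close>.\<close>
  have "K > 0"
    using K by (metis ballot_0 crosses_at_def gr_zeroI less_eq_nat.simps(1) not_one_le_zero)
  then have "crosses_at (q + K) (\<lambda>k. real (0 choose k) +
     (if k < q then 0 else ballot (0 + n) (k - q) - real (0 choose (k - q))))"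
    using K by (auto simp: crosses_at_def zero_choose)
  then show ?case ..
next
  case (Suc m)
  then obtain K where K: "crosses_at K (\<lambda>k. real (m choose k) +
     (if k < q then 0 else ballot (m + n) (k - q) - real (m choose (k - q))))"
    by blast
  show ?case
    using K by (rule crosses_at_step) (auto simp: Suc_diff_le not_less ballot_Suc_Suc
      less_Suc_eq_le le_Suc_eq)
qed

section \<open>Generating functions and the differences of the convolution\<close>

lemma fps_nth_one_plus_X_power: "fps_nth ((1 + fps_X :: real fps) ^ m) k = real (m choose k)"
proof (induction m arbitrary: k)
  case 0
  then show ?case by (cases k) auto
next
  case (Suc m)
  then show ?case by (cases k) (auto simp: distrib_right)
qed

lemma fps_nth_ballot: "fps_nth ((1 - fps_X) * (1 + fps_X :: real fps) ^ N) i = ballot N i"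
  by (simp add: left_diff_distrib fps_nth_one_plus_X_power ballot_def)

lemma one_minus_X_mult_geometric:
  "(1 - fps_X) * Abs_fps (\<lambda>k. if k < p then 1 else 0) = (1 - fps_X ^ p :: real fps)"
  by (rule fps_ext) (auto simp: left_diff_distrib)

lemma seq_conv_Suc:
  "seq_conv s t (Suc k) = fps_nth (Abs_fps (\<lambda>i. s (Suc i)) * Abs_fps (\<lambda>i. t (Suc i))) k"
  using sum.atLeast_Suc_atMost_Suc_shift[of "\<lambda>j. s j * t (Suc k - j + 1)" 0 k]
  by (simp add: seq_conv_def fps_mult_nth)

lemma ones_binom_seq_fps:
  "Abs_fps (\<lambda>i. ones_binom_seq p m (Suc i)) =
     Abs_fps (\<lambda>k. if k < p then 1 else 0) + fps_X ^ p * (1 + fps_X) ^ m"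
  by (rule fps_ext)
    (auto simp: ones_binom_seq_def fps_X_power_mult_nth fps_nth_one_plus_X_power)

definition conv_diff :: "nat \<Rightarrow> nat \<Rightarrow> nat \<Rightarrow> nat \<Rightarrow> nat \<Rightarrow> real" where
  "conv_diff p m q n k =
     seq_conv (ones_binom_seq p m) (ones_binom_seq q n) (Suc k) -
     seq_conv (ones_binom_seq p m) (ones_binom_seq q n) k"

lemma conv_diff_eq:
  "conv_diff p m q n k =
     (if k < q then 1 else 0) - (if p \<le> k \<and> k < p + q then 1 else 0) +
     (if k < q then 0 else real (n choose (k - q))) + (if k < p then 0 else real (m choose (k - p))) +
     (if k < p + q then 0
      else ballot (m + n) (k - (p + q)) - real (m choose (k - (p + q))) - real (n choose (k - (p + q))))"
proof -
  define U :: "nat \<Rightarrow> real fps" where "U p = Abs_fps (\<lambda>k. if k < p then 1 else 0)" for p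
  define A :: "real fps" where "A = (1 + fps_X) ^ m"
  define B :: "real fps" where "B = (1 + fps_X) ^ n"
  define R where "R = (U p + fps_X ^ p * A) * (U q + fps_X ^ q * B)"
  have R: "seq_conv (ones_binom_seq p m) (ones_binom_seq q n) (Suc k) = fps_nth R k" for k
    by (simp add: seq_conv_Suc ones_binom_seq_fps R_def U_def A_def B_def)
  have U: "(1 - fps_X) * U p = 1 - fps_X ^ p" for p
    unfolding U_def by (rule one_minus_X_mult_geometric)
  \<comment> \<open>In every product containing a block of ones, \<open>1 - X\<close> is absorbed by
    one such block; only \<open>A * B\<close> keeps it and yields the ballot terms.\<close>
  have "(1 - fps_X) * R = ((1 - fps_X) * U p) * U q + fps_X ^ q * ((1 - fps_X) * U p) * B
      + fps_X ^ p * ((1 - fps_X) * U q) * A + fps_X ^ p * fps_X ^ q * ((1 - fps_X) * (A * B))"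
    unfolding R_def by (simp add: algebra_simps)
  also have "\<dots> = U q - fps_X ^ p * U q + fps_X ^ q * B - fps_X ^ (p + q) * B + fps_X ^ p * A
      - fps_X ^ (p + q) * A + fps_X ^ (p + q) * ((1 - fps_X) * (A * B))"
    unfolding U power_add by (simp add: algebra_simps)
  finally have D: "(1 - fps_X) * R = \<dots>" .
  have AB: "A * B = (1 + fps_X) ^ (m + n)"
    by (simp add: A_def B_def power_add)
  have "conv_diff p m q n k = fps_nth ((1 - fps_X) * R) k"
    \<comment> \<open>At \<open>k = 0\<close> the subtracted term is an empty sum, matching the
      constant coefficient.\<close>
    by (cases k) (simp_all add: conv_diff_def R left_diff_distrib seq_conv_def[of _ _ 0])
  then show ?thesis
    unfolding D AB
    by (auto simp: fps_X_power_mult_nth fps_nth_ballot U_def A_def B_def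
        fps_nth_one_plus_X_power)
qed

lemma conv_diff_low:
  assumes "k < p + q"
  shows "conv_diff p m q n k =
    (if k < q then 1 else real (n choose (k - q))) + (if k < p then 0 else real (m choose (k - p)) - 1)"
  using assms by (auto simp: conv_diff_eq)

lemma conv_diff_high:
  "conv_diff p m q n (p + q + i) = real (n choose (p + i)) + real (m choose (q + i)) +
     ballot (m + n) i - real (m choose i) - real (n choose i)"
  by (auto simp: conv_diff_eq add.commute add.left_commute)

section \<open>Unimodality from the signs of the differences\<close>

lemma unimodal_convI:
  assumes "crosses_at K (conv_diff p m q n)"
  shows "unimodal (seq_conv (ones_binom_seq p m) (ones_binom_seq q n))"
  unfolding unimodal_def
  \<comment> \<open>A peak index must be at least 1, while \<open>K\<close> may be 0.\<close>
  by (rule exI[of _ "max K 1"]) (use assms in \<open>auto simp: crosses_at_def conv_diff_def\<close>)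

lemma not_unimodal_convI:
  assumes "0 < i" "i < j" "conv_diff p m q n i < 0" "conv_diff p m q n j > 0"
  shows "\<not> unimodal (seq_conv (ones_binom_seq p m) (ones_binom_seq q n))"
proof
  assume "unimodal (seq_conv (ones_binom_seq p m) (ones_binom_seq q n))"
  then obtain k where "\<And>i. 1 \<le> i \<Longrightarrow> i < k \<Longrightarrow> conv_diff p m q n i \<ge> 0"
      and "\<And>i. k \<le> i \<Longrightarrow> conv_diff p m q n i \<le> 0"
    unfolding unimodal_def conv_diff_def by auto
  from this(1)[of i] this(2)[of j] show False
    using assms by linarith
qed

lemma not_unimodal_conv:
  assumes "n \<le> m" "2 \<le> n" "m \<le> q" "n \<le> p" "\<not> (m = 2 \<and> n = 2)"
  shows "\<not> unimodal (seq_conv (ones_binom_seq p m) (ones_binom_seq q n))"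
proof (rule not_unimodal_convI)
  have "conv_diff p m q n (p + q + 1) = -1"
    unfolding conv_diff_high using assms by (simp add: ballot_1 binomial_eq_0)
  then show "conv_diff p m q n (p + q + 1) < 0" by simp
  have choose2: "real (k choose 2) = real k * (real k - 1) / 2" for k
    by (cases k) (auto simp: choose_two real_of_nat_div field_simps)
  have "conv_diff p m q n (p + q + 2) = (real m - 1) * (real n - 1) - 1"
    unfolding conv_diff_high using assms by (simp add: ballot_def choose2 binomial_eq_0 field_simps)
  \<comment> \<open>Excluding \<open>m = n = 2\<close> leaves \<open>m \<ge> 3\<close> and
    \<open>n \<ge> 2\<close>.\<close>
  moreover have "2 * 1 \<le> (real m - 1) * (real n - 1)"
    using assms by (intro mult_mono) auto
  ultimately show "conv_diff p m q n (p + q + 2) > 0" by simp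
qed auto

lemma sum_binomials_ge_1:
  assumes "b \<le> a \<or> d \<le> c"
  shows "1 \<le> real (a choose b) + real (c choose d)"
proof -
  have "1 \<le> (a choose b) + (c choose d)"
    using assms zero_less_binomial[of b a] zero_less_binomial[of d c] by linarith
  then show ?thesis
    by linarith
qed

lemma unimodal_conv_if_less:
  assumes "n \<le> m" "0 < n" "q < m \<or> p < n"
  shows "unimodal (seq_conv (ones_binom_seq p m) (ones_binom_seq q n))"
proof -
  define d where "d = conv_diff p m q n"
  obtain K where K: "crosses_at K (\<lambda>k. real (m choose k) +
     (if k < q then 0 else ballot (m + n) (k - q) - real (m choose (k - q))))"
    using crosses_at_shifted_ballot by blast
  have low: "d k \<ge> 0" if "k < p + q" for k
  proof -
    have "1 \<le> real (n choose (k - q)) + real (m choose (k - p))"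
      using assms(3) that by (intro sum_binomials_ge_1) linarith
    then show ?thesis
      using that by (auto simp: d_def conv_diff_low)
  qed
  have mid: "d (p + q + i) \<ge> 0" if "i \<le> n" for i
  proof -
    consider "i = 0" | "i = 1" | "2 \<le> i" by linarith
    then show ?thesis
    proof cases
      case 1
      then show ?thesis
        using assms sum_binomials_ge_1[of p n q m] conv_diff_high[of p m q n 0]
        by (simp add: d_def) linarith
    next
      \<comment> \<open>The ballot term minus \<open>m\<close> and \<open>n\<close> is -1, so one of
        \<open>C(n, p + 1)\<close>, \<open>C(m, q + 1)\<close> must be positive: this is exactly
        \<open>p < n\<close> or \<open>q < m\<close>.\<close>
      case 2
      then show ?thesis
        using assms sum_binomials_ge_1[of "Suc p" n "Suc q" m] conv_diff_high[of p m q n 1]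
        by (simp add: d_def ballot_1) linarith
    next
      case 3
      then show ?thesis
        using ballot_ge_binomials[of i m n] assms that by (auto simp: d_def conv_diff_high)
    qed
  qed
  have high: "d (p + q + i) = real (m choose (q + i)) + ballot (m + n) i - real (m choose i)"
    if "n < i" for i
    using that by (simp add: d_def conv_diff_high binomial_eq_0)
  have high_nonneg: "d (p + q + i) \<ge> 0" if "n < i" "q + i < K" for i
    using that K high[of i] by (auto simp: crosses_at_def dest!: spec[of _ "q + i"])
  have high_nonpos: "d (p + q + i) \<le> 0" if "n < i" "K \<le> q + i" for i
    using that K high[of i] by (auto simp: crosses_at_def dest!: spec[of _ "q + i"])
  \<comment> \<open>The crossing \<open>q + i = K\<close> sits at index
    \<open>p + q + i = p + K\<close>; the maximum covers the range \<open>i \<le> n\<close>, already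
    known to be nonnegative.\<close>
  define T where "T = max (p + q + n + 1) (p + K)"
  have "d k \<ge> 0" if "k < T" for k
  proof -
    consider "k < p + q" | "p + q \<le> k" "k \<le> p + q + n" | "p + q + n < k" by linarith
    then show ?thesis
    proof cases
      case 2
      then show ?thesis using mid[of "k - (p + q)"] by simp
    next
      case 3
      then have "q + (k - (p + q)) < K" using that by (auto simp: T_def)
      then show ?thesis
        using 3 high_nonneg[of "k - (p + q)"] by auto
    qed (rule low)
  qed
  moreover have "d k \<le> 0" if "T \<le> k" for k
  proof -
    have "K \<le> q + (k - (p + q))" "p + q + n < k" using that by (auto simp: T_def)
    then show ?thesis
      using high_nonpos[of "k - (p + q)"] by auto
  qed
  ultimately have "crosses_at T (conv_diff p m q n)"
    by (simp add: crosses_at_def d_def)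
  then show ?thesis by (rule unimodal_convI)
qed

lemma unimodal_conv_exceptional:
  assumes "m \<le> q" "n \<le> p" "n = 1 \<or> (m = 2 \<and> n = 2)"
  shows "unimodal (seq_conv (ones_binom_seq p m) (ones_binom_seq q n))"
proof -
  have tail: "ballot (m + n) (Suc i) \<le> real (m choose Suc i) + real (n choose Suc i)" for i
    using assms(3)
  proof
    assume "n = 1"
    then show ?thesis by (cases i) (simp_all add: ballot_def)
  next
    assume "m = 2 \<and> n = 2"
    then show ?thesis
      by (cases "i = 0"; cases "i = 1"; cases "i = 2"; cases "i = 3")
        (simp_all add: ballot_def numeral_eq_Suc binomial_eq_0)
  qed
  \<comment> \<open>Up to \<open>T\<close> at least one of \<open>C(n, k - q)\<close>,
    \<open>C(m, k - p)\<close> is positive; beyond it both vanish, leaving -1 until index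
    \<open>p + q\<close>, after which \<open>tail\<close> takes over.\<close>
  define T where "T = max (q + n) (p + m)"
  have T: "T \<le> p + q" using assms by (auto simp: T_def)
  have "conv_diff p m q n k \<ge> 0" if "k \<le> T" for k
  proof (cases "k < p + q")
    case True
    have "1 \<le> real (n choose (k - q)) + real (m choose (k - p))"
      using that by (intro sum_binomials_ge_1) (auto simp: T_def le_max_iff_disj)
    with True show ?thesis
      by (auto simp: conv_diff_low)
  next
    case False
    then have "k = p + q + 0" "p = n \<or> q = m" using that T assms by (auto simp: T_def le_max_iff_disj)
    then show ?thesis by (auto simp only: conv_diff_high) auto
  qed
  moreover have "conv_diff p m q n k \<le> 0" if "T < k" for k
  proof -
    consider "k < p + q" | "k = p + q + 0" | i where "k = p + q + Suc i"
      by (metis add.right_neutral less_imp_Suc_add add_Suc_right linorder_neqE_nat)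
    then show ?thesis
    proof cases
      case 1
      then show ?thesis using that by (auto simp: T_def conv_diff_low binomial_eq_0)
    next
      case 2
      then have "n < p" "m < q" using that by (auto simp: T_def)
      with 2 show ?thesis by (simp only: conv_diff_high) (simp add: binomial_eq_0)
    next
      case 3
      then show ?thesis using tail[of i] assms(1,2) by (simp only: conv_diff_high) (simp add: binomial_eq_0)
    qed
  qed
  ultimately have "crosses_at (Suc T) (conv_diff p m q n)"
    by (simp add: crosses_at_def Suc_le_eq less_Suc_eq_le)
  then show ?thesis by (rule unimodal_convI)
qed

theorem theorem1p2:
  fixes m n p q :: nat
  assumes "m \<ge> n" and "n > 0"
  shows "unimodal (seq_conv (ones_binom_seq p m) (ones_binom_seq q n)) \<longleftrightarrow>
    m > q \<or> n > p \<or> (m = 2 \<and> n = 2) \<or> n = 1"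
proof (cases "q < m \<or> p < n")
  case True
  then show ?thesis
    using unimodal_conv_if_less[of n m q p] assms by auto
next
  case False
  then show ?thesis
    using unimodal_conv_exceptional[of m q n p] not_unimodal_conv[of n m q p] assms by force
qed

end
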